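(* Let $M\in\mathbb{R}^{n\times n}$ with $\|M\|_F^2=1$ and singular value decomposition $M=U\Sigma V^\top$, where $\Sigma=\operatorname{diag}(\sigma_1,\dots,\sigma_n)$ with $0\le\sigma_k\le1$, and where $U$ is Haar distributed on the orthogonal group. Let $a,b,c\in\mathbb{R}$, $\varphi(x):=ax+bx^3+cx^5$, $\lambda_k:=\sigma_k^2$, and $$Q:=aM+b(MM^\top)M+c(MM^\top)^2M .$$ Assume that $a=\varphi'(0)>1$. Then there exists $\delta>0$ such that, whenever $$\lambda_1,\dots,\lambda_n\in[0,\delta]$$ are not all equal, $$\mathbb{E}\bigl[\operatorname{Var}(s(Q))-\operatorname{Var}(s(M))\bigr]>0 .$$ In particular, the expected variance shift of one polar step, i.e. $\mathbb{E}[\operatorname{Var}(s(Q))-\operatorname{Var}(s(M))]$, can be positive.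
   Context: For $X\in\mathbb{R}^{n\times n}$ with rows $X_{1:},\dots,X_{n:}$, define $s(X):=(\|X_{1:}\|_2^2,\dots,\|X_{n:}\|_2^2)$, the vector of squared Euclidean row norms, and $$\operatorname{Var}(s(X)):=\frac1n\sum_{i=1}^n\Bigl(\|X_{i:}\|_2^2-\frac1n\|X\|_F^2\Bigr)^2 .$$ Here $\|\cdot\|_F$ is the Frobenius norm, the orthogonal group is the group of all real $n\times n$ matrices $U$ with $U^\top U=I$, the singular values $\sigma_k$ are fixed, and the expectation is over the Haar-distributed $U$. The map $M\mapsto Q$ is one Newton–Schulz (polar) step, and $Q=U\varphi(\Sigma)V^\top$ with $\varphi$ applied to the diagonal entries. *)

theory Defs
  imports "HOL-Probability.Probability" "Jordan_Normal_Form.Matrix"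
begin

text \<open>
  Matrices are those of \<open>Jordan_Normal_Form\<close>: the dimension is a value and not a type, which allows
  a bound to be uniform in the dimension.
\<close>

definition orthogonal_group :: "nat \<Rightarrow> real mat set" where
  "orthogonal_group n = {U \<in> carrier_mat n n. transpose_mat U * U = 1\<^sub>m n}"

text \<open>
  The Borel sets of the orthogonal group, as a subspace of the Euclidean space of all matrices, are
  generated by the entry functions.
\<close>

definition orthogonal_borel :: "nat \<Rightarrow> real mat measure" where
  "orthogonal_borel n = sigma (orthogonal_group n)
     {{U \<in> orthogonal_group n. U $$ (i, j) \<in> B} | i j B. i < n \<and> j < n \<and> B \<in> sets (borel :: real measure)}"

text \<open>
  The Haar probability measure is characterised as the left-invariant Borel probability measure; the
  group is compact, so there is exactly one such measure and it is right-invariant as well.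
\<close>

definition haar_orthogonal :: "nat \<Rightarrow> real mat measure \<Rightarrow> bool" where
  "haar_orthogonal n \<mu> \<longleftrightarrow>
     prob_space \<mu> \<and> space \<mu> = orthogonal_group n \<and> sets \<mu> = sets (orthogonal_borel n) \<and>
     (\<forall>W \<in> orthogonal_group n. distr \<mu> \<mu> (\<lambda>U. W * U) = \<mu>)"

definition frobenius_norm :: "real mat \<Rightarrow> real" where
  "frobenius_norm X = sqrt (\<Sum>i<dim_row X. \<Sum>j<dim_col X. (X $$ (i, j))\<^sup>2)"

definition sq_row_norms :: "real mat \<Rightarrow> real Matrix.vec" where
  "sq_row_norms X = Matrix.vec (dim_row X) (\<lambda>i. \<Sum>j<dim_col X. (X $$ (i, j))\<^sup>2)"

text \<open>The quantity $\mathrm{Var}(s(X))$, as a function of the matrix $X$:\<close>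

definition row_norm_variance :: "real mat \<Rightarrow> real" where
  "row_norm_variance X =
     (1 / real (dim_row X)) * (\<Sum>i<dim_row X.
        (vec_index (sq_row_norms X) i - (1 / real (dim_row X)) * (frobenius_norm X)\<^sup>2)\<^sup>2)"

definition ns_poly :: "real \<Rightarrow> real \<Rightarrow> real \<Rightarrow> real \<Rightarrow> real" where
  "ns_poly a b c x = a * x + b * x ^ 3 + c * x ^ 5"

lemma deriv_ns_poly_0: "deriv (ns_poly a b c) 0 = a"
  by (rule DERIV_imp_deriv) (auto simp: ns_poly_def [abs_def] intro!: derivative_eq_intros)

definition newton_schulz :: "real \<Rightarrow> real \<Rightarrow> real \<Rightarrow> real mat \<Rightarrow> real mat" where
  "newton_schulz a b c M =
     a \<cdot>\<^sub>m M + b \<cdot>\<^sub>m ((M * transpose_mat M) * M) + c \<cdot>\<^sub>m (((M * transpose_mat M) ^\<^sub>m 2) * M)"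

definition svd_mat :: "nat \<Rightarrow> (nat \<Rightarrow> real) \<Rightarrow> real mat \<Rightarrow> real mat \<Rightarrow> real mat" where
  "svd_mat n \<sigma> V U = U * mat_diag n \<sigma> * transpose_mat V"

definition expected_variance_shift ::
  "real \<Rightarrow> real \<Rightarrow> real \<Rightarrow> nat \<Rightarrow> (nat \<Rightarrow> real) \<Rightarrow> real mat \<Rightarrow> real mat measure \<Rightarrow> real" where
  "expected_variance_shift a b c n \<sigma> V \<mu> =
     (\<integral>U. row_norm_variance (newton_schulz a b c (svd_mat n \<sigma> V U))
          - row_norm_variance (svd_mat n \<sigma> V U) \<partial>\<mu>)"

text \<open>
  The standing assumptions on the deterministic data. The norm condition is on the matrix
  \<open>U \<Sigma> V\<^sup>T\<close> for every value that \<open>U\<close> can take.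
\<close>

definition admissible :: "nat \<Rightarrow> (nat \<Rightarrow> real) \<Rightarrow> real mat \<Rightarrow> bool" where
  "admissible n \<sigma> V \<longleftrightarrow>
     V \<in> orthogonal_group n \<and> (\<forall>k<n. 0 \<le> \<sigma> k \<and> \<sigma> k \<le> 1) \<and>
     (\<forall>U \<in> orthogonal_group n. (frobenius_norm (svd_mat n \<sigma> V U))\<^sup>2 = 1)"

end

theory Submission
  imports Defs
begin

text \<open>
  Write \<open>S = U diag(x) U\<^sup>T\<close>; with \<open>x = \<sigma>\<^sup>2\<close> the squared row norms of \<open>U \<Sigma> V\<^sup>T\<close> are the diagonal
  entries of \<open>S\<close>. Replacing the rows \<open>u\<^sub>i, u\<^sub>j\<close> of \<open>U\<close> by \<open>(u\<^sub>i \<plusminus> u\<^sub>j) / \<surd>2\<close> is a left multiplication by an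
  orthogonal matrix and turns \<open>S\<^sub>i\<^sub>i - S\<^sub>j\<^sub>j\<close> into \<open>2 S\<^sub>i\<^sub>j\<close>, so that left invariance alone gives
  \<open>E (S\<^sub>i\<^sub>i - S\<^sub>j\<^sub>j)\<^sup>2 = 4 E S\<^sub>i\<^sub>j\<^sup>2\<close>. Since \<open>tr S\<close> and \<open>tr S\<^sup>2\<close> do not depend on \<open>U\<close>, summing over \<open>i\<close> and \<open>j\<close>
  determines the expected variance as \<open>\<Sum>\<^sub>k\<^sub>l (x\<^sub>k - x\<^sub>l)\<^sup>2 / (n\<^sup>2 (n + 2))\<close>. As \<open>Q\<close> is \<open>M\<close> with \<open>\<sigma>\<close> replaced by
  \<open>\<phi>(\<sigma>)\<close>, it remains that \<open>\<sigma>\<^sup>2 \<mapsto> \<phi>(\<sigma>)\<^sup>2\<close> strictly expands distances near 0, uniformly in \<open>n\<close>.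
\<close>

section \<open>The orthogonal group in terms of matrix entries\<close>

lemma orthogonal_groupD:
  assumes "U \<in> orthogonal_group n"
  shows "U \<in> carrier_mat n n" "dim_row U = n" "dim_col U = n" "transpose_mat U * U = 1\<^sub>m n"
  using assms by (auto simp: orthogonal_group_def)

lemma mult_mat_entry:
  assumes "A \<in> carrier_mat m p" "B \<in> carrier_mat p q" "i < m" "j < q"
  shows "(A * B) $$ (i, j) = (\<Sum>k<p. A $$ (i, k) * B $$ (k, j))"
  using assms by (auto simp: scalar_prod_def atLeast0LessThan intro!: sum.cong)

lemma orthogonal_group_iff:
  "U \<in> orthogonal_group n \<longleftrightarrow> U \<in> carrier_mat n n \<and>
     (\<forall>k<n. \<forall>l<n. (\<Sum>i<n. U $$ (i, k) * U $$ (i, l)) = (if k = l then 1 else 0))"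
proof (cases "U \<in> carrier_mat n n")
  case True
  have "(transpose_mat U * U) $$ (k, l) = (\<Sum>i<n. U $$ (i, k) * U $$ (i, l))" if "k < n" "l < n" for k l
    using True that by (subst mult_mat_entry[where m = n and p = n and q = n]) auto
  moreover have "transpose_mat U * U = 1\<^sub>m n \<longleftrightarrow>
      (\<forall>k<n. \<forall>l<n. (transpose_mat U * U) $$ (k, l) = (if k = l then 1 else 0))"
    using True by (auto simp: mat_eq_iff)
  ultimately show ?thesis
    using True by (auto simp: orthogonal_group_def)
qed (simp add: orthogonal_group_def)

lemma one_mat_orthogonal: "1\<^sub>m n \<in> orthogonal_group n"
  by (simp add: orthogonal_group_def)

lemma mult_orthogonal:
  assumes "W \<in> orthogonal_group n" "U \<in> orthogonal_group n"
  shows "W * U \<in> orthogonal_group n"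
proof -
  note c = orthogonal_groupD(1)[OF assms(1)] orthogonal_groupD(1)[OF assms(2)]
  have "transpose_mat (W * U) * (W * U) = transpose_mat U * (transpose_mat W * (W * U))"
    using c by (simp add: transpose_mult[OF c] assoc_mult_mat[of _ n n _ n _ n])
  also have "transpose_mat W * (W * U) = U"
    using c orthogonal_groupD(4)[OF assms(1)]
    by (simp add: assoc_mult_mat[of _ n n _ n _ n, symmetric])
  finally show ?thesis
    using c orthogonal_groupD(4)[OF assms(2)] by (simp add: orthogonal_group_def)
qed

lemma orthogonal_entry_abs_le_1:
  assumes "U \<in> orthogonal_group n" "i < n" "k < n"
  shows "\<bar>U $$ (i, k)\<bar> \<le> 1"
proof -
  have "(U $$ (i, k))\<^sup>2 \<le> (\<Sum>i<n. (U $$ (i, k))\<^sup>2)"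
    using assms by (intro member_le_sum) auto
  also have "\<dots> = 1"
    using assms by (auto simp: orthogonal_group_iff power2_eq_square)
  finally show ?thesis
    by (simp add: abs_square_le_1)
qed

lemma sum_rotate_three:
  "(\<Sum>j\<in>A. \<Sum>k\<in>B. \<Sum>l\<in>C. g j k l) = (\<Sum>k\<in>B. \<Sum>l\<in>C. \<Sum>j\<in>A. g j k l)"
  by (subst sum.swap) (intro sum.cong refl sum.swap)

section \<open>The matrix \<open>U diag(x) U^T\<close> and its invariants\<close>

text \<open>Entry (i, j) of \<open>U diag(x) U^T\<close>, kept as a scalar polynomial in the entries
  of \<open>U\<close>, so that measurability and bounds follow term by term.\<close>

definition conj_diag :: "nat \<Rightarrow> (nat \<Rightarrow> real) \<Rightarrow> real mat \<Rightarrow> nat \<Rightarrow> nat \<Rightarrow> real" where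
  "conj_diag n x U i j = (\<Sum>k<n. x k * U $$ (i, k) * U $$ (j, k))"

lemma trace_conj_diag:
  assumes "U \<in> orthogonal_group n"
  shows "(\<Sum>i<n. conj_diag n x U i i) = (\<Sum>k<n. x k)"
proof -
  have "(\<Sum>i<n. conj_diag n x U i i) = (\<Sum>k<n. x k * (\<Sum>i<n. U $$ (i, k) * U $$ (i, k)))"
    unfolding conj_diag_def by (subst sum.swap) (simp add: sum_distrib_left mult_ac)
  also have "\<dots> = (\<Sum>k<n. x k)"
    using assms by (auto simp: orthogonal_group_iff intro!: sum.cong)
  finally show ?thesis .
qed

text \<open>Conjugation by an orthogonal matrix preserves the Frobenius norm. Once the square is
  expanded, the sums over i and j factor into the squared inner product of columns k and l of
  \<open>U\<close>, which leaves only k = l.\<close>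

lemma sum_squares_conj_diag:
  assumes "U \<in> orthogonal_group n"
  shows "(\<Sum>i<n. \<Sum>j<n. (conj_diag n x U i j)\<^sup>2) = (\<Sum>k<n. (x k)\<^sup>2)"
proof -
  let ?t = "\<lambda>i j k l. (x k * U $$ (i, k) * U $$ (j, k)) * (x l * U $$ (i, l) * U $$ (j, l))"
  have "(\<Sum>i<n. \<Sum>j<n. (conj_diag n x U i j)\<^sup>2) = (\<Sum>i<n. \<Sum>j<n. \<Sum>k<n. \<Sum>l<n. ?t i j k l)"
    unfolding conj_diag_def power2_eq_square sum_product ..
  also have "\<dots> = (\<Sum>k<n. \<Sum>l<n. \<Sum>i<n. \<Sum>j<n. ?t i j k l)"
    proof -
    \<comment> \<open>Two rotations bring k and l to the front: first j moves past them, then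
      i.\<close>
    have "(\<Sum>j<n. \<Sum>k<n. \<Sum>l<n. ?t i j k l) = (\<Sum>k<n. \<Sum>l<n. \<Sum>j<n. ?t i j k l)" for i
      by (rule sum_rotate_three)
    then show ?thesis
      by (simp only:) (rule sum_rotate_three)
  qed
  also have "\<dots> = (\<Sum>k<n. \<Sum>l<n. x k * x l * (\<Sum>i<n. U $$ (i, k) * U $$ (i, l))\<^sup>2)"
    unfolding power2_eq_square sum_product by (simp add: sum_distrib_left mult_ac)
  also have "\<dots> = (\<Sum>k<n. \<Sum>l<n. if k = l then x k * x l else 0)"
    by (intro sum.cong refl) (use assms in \<open>auto simp: orthogonal_group_iff\<close>)
  also have "\<dots> = (\<Sum>k<n. (x k)\<^sup>2)"
    by (simp add: power2_eq_square)
  finally show ?thesis .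
qed

lemma sum_square_differences:
  fixes y :: "nat \<Rightarrow> real"
  shows "(\<Sum>i<n. \<Sum>j<n. (y i - y j)\<^sup>2) = 2 * real n * (\<Sum>i<n. (y i)\<^sup>2) - 2 * (\<Sum>i<n. y i)\<^sup>2"
proof -
  have "(\<Sum>i<n. \<Sum>j<n. (y i - y j)\<^sup>2) = (\<Sum>i<n. \<Sum>j<n. (y i)\<^sup>2 + (y j)\<^sup>2 - 2 * (y i * y j))"
    by (simp add: power2_diff algebra_simps)
  also have "\<dots> = 2 * real n * (\<Sum>i<n. (y i)\<^sup>2) - 2 * (\<Sum>i<n. \<Sum>j<n. y i * y j)"
    by (simp add: sum.distrib sum_subtractf sum_distrib_left[symmetric])
  finally show ?thesis
    by (simp add: power2_eq_square sum_product)
qed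

section \<open>The reflection that mixes two rows\<close>

text \<open>For i and j distinct, the identity except in the plane of coordinates i and j, where it
  is the symmetric reflection with rows (1, 1) and (1, -1), scaled by
  \<open>1 / sqrt 2\<close>.\<close>

definition mix_rows :: "nat \<Rightarrow> nat \<Rightarrow> nat \<Rightarrow> real mat" where
  "mix_rows n i j = Matrix.mat n n (\<lambda>(r, s).
     if r = i then (if s = i \<or> s = j then 1 / sqrt 2 else 0)
     else if r = j then (if s = i then 1 / sqrt 2 else if s = j then - 1 / sqrt 2 else 0)
     else if r = s then 1 else 0)"

lemma sum_split_two:
  fixes f :: "nat \<Rightarrow> real"
  assumes "i < n" "j < n" "i \<noteq> j"
  shows "(\<Sum>k<n. f k) = f i + f j + (\<Sum>k\<in>{..<n} - {i, j}. f k)"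
proof -
  have "(\<Sum>k<n. f k) = (\<Sum>k\<in>{..<n} - {i, j}. f k) + (\<Sum>k\<in>{i, j}. f k)"
    using assms by (intro sum.subset_diff) auto
  then show ?thesis using assms by simp
qed

lemma mix_rows_orthogonal:
  assumes "i < n" "j < n" "i \<noteq> j"
  shows "mix_rows n i j \<in> orthogonal_group n"
proof -
  let ?W = "mix_rows n i j"
  have "(\<Sum>k<n. ?W $$ (k, r) * ?W $$ (k, s)) = (if r = s then 1 else 0)" if "r < n" "s < n" for r s
  proof -
    \<comment> \<open>Rows other than i and j are those of the identity, so only k = r = s
      contributes here. The two terms split off give 1/2 + 1/2 or 1/2 - 1/2 on columns i and
      j.\<close>
    have "(\<Sum>k\<in>{..<n} - {i, j}. ?W $$ (k, r) * ?W $$ (k, s)) =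
        (\<Sum>k\<in>{..<n} - {i, j}. if k = r then (if r = s then 1 else 0) else 0)"
      using that by (intro sum.cong) (auto simp: mix_rows_def)
    also have "\<dots> = (if r \<noteq> i \<and> r \<noteq> j \<and> r = s then 1 else 0)"
      using that by simp
    finally show ?thesis
      using that assms unfolding sum_split_two[OF assms] by (simp add: mix_rows_def)
  qed
  then show ?thesis
    by (auto simp: orthogonal_group_iff) (simp add: mix_rows_def)
qed

lemma mix_rows_mult_entry:
  assumes "i < n" "j < n" "i \<noteq> j" "U \<in> carrier_mat n n" "k < n"
  shows "(mix_rows n i j * U) $$ (i, k) = (U $$ (i, k) + U $$ (j, k)) / sqrt 2"
    and "(mix_rows n i j * U) $$ (j, k) = (U $$ (i, k) - U $$ (j, k)) / sqrt 2"
proof -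
  have c: "mix_rows n i j \<in> carrier_mat n n"
    by (simp add: mix_rows_def)
  show "(mix_rows n i j * U) $$ (i, k) = (U $$ (i, k) + U $$ (j, k)) / sqrt 2"
    unfolding mult_mat_entry[OF c assms(4,1,5)] sum_split_two[OF assms(1-3)]
    using assms by (simp add: mix_rows_def add_divide_distrib)
  show "(mix_rows n i j * U) $$ (j, k) = (U $$ (i, k) - U $$ (j, k)) / sqrt 2"
    unfolding mult_mat_entry[OF c assms(4,2,5)] sum_split_two[OF assms(1-3)]
    using assms by (simp add: mix_rows_def diff_divide_distrib)
qed

text \<open>Polarisation of the quadratic form \<open>diag(x)\<close> at the two rows. Subtracting
  the two identities leaves twice the off-diagonal entry.\<close>

lemma conj_diag_mix_rows:
  assumes "i < n" "j < n" "i \<noteq> j" "U \<in> carrier_mat n n"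
  shows "conj_diag n x (mix_rows n i j * U) i i =
      (conj_diag n x U i i + conj_diag n x U j j) / 2 + conj_diag n x U i j"
    and "conj_diag n x (mix_rows n i j * U) j j =
      (conj_diag n x U i i + conj_diag n x U j j) / 2 - conj_diag n x U i j"
  unfolding conj_diag_def
  by (simp_all add: mix_rows_mult_entry[OF assms] sum.distrib[symmetric] sum_subtractf[symmetric] sum_divide_distrib
     field_simps cong: sum.cong_simp)
     
text \<open>Columns of \<open>U\<close> are unit vectors, so its entries are at most 1 in absolute
  value. This bound, uniform in \<open>U\<close>, is the source of integrability below.\<close>

lemma conj_diag_bound:
  assumes "U \<in> orthogonal_group n" "i < n" "j < n"
  shows "\<bar>conj_diag n x U i j\<bar> \<le> (\<Sum>k<n. \<bar>x k\<bar>)"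
  unfolding conj_diag_def
proof (intro order.trans[OF sum_abs] sum_mono)
  fix k assume "k \<in> {..<n}"
  then have "\<bar>U $$ (i, k)\<bar> * \<bar>U $$ (j, k)\<bar> \<le> 1 * 1"
    using assms by (intro mult_mono orthogonal_entry_abs_le_1) auto
  then show "\<bar>x k * U $$ (i, k) * U $$ (j, k)\<bar> \<le> \<bar>x k\<bar>"
    by (simp add: abs_mult mult.assoc mult_left_le)
qed


section \<open>Measurability, invariance and integrability for Haar measure\<close>

lemma haar_orthogonalD:
  assumes "haar_orthogonal n \<mu>"
  shows "prob_space \<mu>" "space \<mu> = orthogonal_group n" "sets \<mu> = sets (orthogonal_borel n)"
    "W \<in> orthogonal_group n \<Longrightarrow> distr \<mu> \<mu> (\<lambda>U. W * U) = \<mu>"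
  using assms by (auto simp: haar_orthogonal_def)

lemma sets_orthogonal_borel:
  "sets (orthogonal_borel n) = sigma_sets (orthogonal_group n)
     {{U \<in> orthogonal_group n. U $$ (i, j) \<in> B} | i j B. i < n \<and> j < n \<and> B \<in> sets (borel :: real measure)}"
  unfolding orthogonal_borel_def by (rule sets_measure_of) auto

lemma measurable_entry:
  assumes "haar_orthogonal n \<mu>" "i < n" "j < n"
  shows "(\<lambda>U. U $$ (i, j)) \<in> borel_measurable \<mu>"
proof (rule measurableI)
  fix B :: "real set" assume "B \<in> sets borel"
  moreover have "(\<lambda>U. U $$ (i, j)) -` B \<inter> space \<mu> = {U \<in> orthogonal_group n. U $$ (i, j) \<in> B}"
    using haar_orthogonalD(2)[OF assms(1)] by auto
  ultimately show "(\<lambda>U. U $$ (i, j)) -` B \<inter> space \<mu> \<in> sets \<mu>"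
    using assms(2,3) unfolding haar_orthogonalD(3)[OF assms(1)] sets_orthogonal_borel
    by (intro sigma_sets.Basic) blast
qed simp

text \<open>The change of variables along left multiplication requires a measurable map. It suffices
  to test the generators, and each entry of \<open>W * U\<close> is a linear combination of entries
  of \<open>U\<close>.\<close>

lemma measurable_mult_left:
  assumes "haar_orthogonal n \<mu>" "W \<in> orthogonal_group n"
  shows "(\<lambda>U. W * U) \<in> measurable \<mu> \<mu>"
proof -
  let ?G = "{{U \<in> orthogonal_group n. U $$ (i, j) \<in> B} | i j B.
      i < n \<and> j < n \<and> B \<in> sets (borel :: real measure)}"
  note sp = haar_orthogonalD(2)[OF assms(1)]
  have "(\<lambda>U. W * U) \<in> measurable \<mu> (sigma (orthogonal_group n) ?G)"
  proof (rule measurable_measure_of)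
    show "?G \<subseteq> Pow (orthogonal_group n)" by auto
    show "(\<lambda>U. W * U) \<in> space \<mu> \<rightarrow> orthogonal_group n"
      using assms(2) sp by (auto intro: mult_orthogonal)
    fix A assume "A \<in> ?G"
    then obtain i j and B :: "real set" where *: "i < n" "j < n" "B \<in> sets borel"
      and A: "A = {U \<in> orthogonal_group n. U $$ (i, j) \<in> B}"
      by blast
    have "(\<lambda>U. \<Sum>k<n. W $$ (i, k) * U $$ (k, j)) \<in> borel_measurable \<mu>"
      using * by (intro borel_measurable_sum borel_measurable_times borel_measurable_const
          measurable_entry[OF assms(1)]) auto
    then have "(\<lambda>U. \<Sum>k<n. W $$ (i, k) * U $$ (k, j)) -` B \<inter> space \<mu> \<in> sets \<mu>"
      using * by (auto intro: measurable_sets)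
    also have "(\<lambda>U. \<Sum>k<n. W $$ (i, k) * U $$ (k, j)) -` B \<inter> space \<mu> = (\<lambda>U. W * U) -` A \<inter> space \<mu>"
    proof -
      have "(\<Sum>k<n. W $$ (i, k) * U $$ (k, j)) = (W * U) $$ (i, j)" if "U \<in> orthogonal_group n" for U
        using mult_mat_entry[OF orthogonal_groupD(1)[OF assms(2)] orthogonal_groupD(1)[OF that] *(1,2)] ..
      then show ?thesis
        using assms(2) unfolding sp A by (auto simp del: index_mult_mat intro: mult_orthogonal)
    qed
    finally show "(\<lambda>U. W * U) -` A \<inter> space \<mu> \<in> sets \<mu>" .
  qed
  \<comment> \<open>Measurability sees only the sigma-algebra of the target, and the generated one
    is that of \<open>\<mu>\<close>.\<close>
  moreover have "measurable \<mu> (sigma (orthogonal_group n) ?G) = measurable \<mu> \<mu>"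
    using haar_orthogonalD(3)[OF assms(1)]
    by (intro measurable_cong_sets) (simp_all add: orthogonal_borel_def)
  ultimately show ?thesis by simp
qed

lemma haar_integral_mult_left:
  fixes f :: "real mat \<Rightarrow> real"
  assumes "haar_orthogonal n \<mu>" "W \<in> orthogonal_group n" "f \<in> borel_measurable \<mu>"
  shows "(\<integral>U. f (W * U) \<partial>\<mu>) = (\<integral>U. f U \<partial>\<mu>)"
  using integral_distr[OF measurable_mult_left[OF assms(1,2)] assms(3)]
  by (simp add: haar_orthogonalD(4)[OF assms(1,2)])

lemma measurable_conj_diag:
  assumes "haar_orthogonal n \<mu>" "i < n" "j < n"
  shows "(\<lambda>U. conj_diag n x U i j) \<in> borel_measurable \<mu>"
  unfolding conj_diag_def using assms
  by (auto intro!: borel_measurable_sum borel_measurable_times measurable_entry[OF assms(1)])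

lemma integrable_conj_diag_mult:
  assumes "haar_orthogonal n \<mu>" "i < n" "j < n" "k < n" "l < n"
  shows "integrable \<mu> (\<lambda>U. conj_diag n x U i j * conj_diag n x U k l)"
proof -
  interpret prob_space \<mu> by (rule haar_orthogonalD(1)[OF assms(1)])
  have "\<bar>conj_diag n x U i j * conj_diag n x U k l\<bar> \<le> (\<Sum>k<n. \<bar>x k\<bar>) * (\<Sum>k<n. \<bar>x k\<bar>)"
    if "U \<in> orthogonal_group n" for U
    unfolding abs_mult using that assms by (intro mult_mono conj_diag_bound) (auto intro: sum_nonneg)
  then show ?thesis
    using assms haar_orthogonalD(2)[OF assms(1)]
    by (intro integrable_const_bound[where B = "(\<Sum>k<n. \<bar>x k\<bar>) * (\<Sum>k<n. \<bar>x k\<bar>)"] AE_I2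
        borel_measurable_times measurable_conj_diag) auto
qed

lemma integrable_conj_diag_square:
  assumes "haar_orthogonal n \<mu>" "i < n" "j < n"
  shows "integrable \<mu> (\<lambda>U. (conj_diag n x U i j)\<^sup>2)"
    and "integrable \<mu> (\<lambda>U. (conj_diag n x U i i - conj_diag n x U j j)\<^sup>2)"
proof -
  note int = integrable_conj_diag_mult[OF assms(1)]
  show sq: "integrable \<mu> (\<lambda>U. (conj_diag n x U i j)\<^sup>2)"
    unfolding power2_eq_square using assms by (intro int)
  have "integrable \<mu> (\<lambda>U. conj_diag n x U i i * conj_diag n x U i i
      + conj_diag n x U j j * conj_diag n x U j j - 2 * (conj_diag n x U i i * conj_diag n x U j j))"
    using assms by (intro Bochner_Integration.integrable_diff Bochner_Integration.integrable_add
        integrable_mult_right int) auto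
  then show "integrable \<mu> (\<lambda>U. (conj_diag n x U i i - conj_diag n x U j j)\<^sup>2)"
    by (simp add: power2_eq_square algebra_simps)
qed

section \<open>Second moments of the diagonal entries\<close>

text \<open>The only place where invariance enters: under \<open>mix_rows n i j\<close> the
  integrand on the left becomes \<open>(2 S_ij)^2\<close>.\<close>

lemma integral_diagonal_difference:
  assumes "haar_orthogonal n \<mu>" "i < n" "j < n" "i \<noteq> j"
  shows "(\<integral>U. (conj_diag n x U i i - conj_diag n x U j j)\<^sup>2 \<partial>\<mu>) = 4 * (\<integral>U. (conj_diag n x U i j)\<^sup>2 \<partial>\<mu>)"
proof -
  let ?f = "\<lambda>U. (conj_diag n x U i i - conj_diag n x U j j)\<^sup>2"
  have meas: "?f \<in> borel_measurable \<mu>"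
    using integrable_conj_diag_square(2)[OF assms(1-3)] by auto
  have "(\<integral>U. ?f U \<partial>\<mu>) = (\<integral>U. ?f (mix_rows n i j * U) \<partial>\<mu>)"
    using haar_integral_mult_left[OF assms(1) mix_rows_orthogonal[OF assms(2-4)] meas] by simp
  also have "\<dots> = (\<integral>U. 4 * (conj_diag n x U i j)\<^sup>2 \<partial>\<mu>)"
    by (intro Bochner_Integration.integral_cong refl)
      (simp add: haar_orthogonalD(2)[OF assms(1)] conj_diag_mix_rows[OF assms(2-4) orthogonal_groupD(1)]
        power2_eq_square algebra_simps)
  finally show ?thesis by simp
qed

lemma integral_double_sum:
  fixes f :: "'i \<Rightarrow> 'j \<Rightarrow> 'a \<Rightarrow> real"
  assumes "\<And>i j. i \<in> A \<Longrightarrow> j \<in> B \<Longrightarrow> integrable M (f i j)"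
  shows "(\<integral>x. (\<Sum>i\<in>A. \<Sum>j\<in>B. f i j x) \<partial>M) = (\<Sum>i\<in>A. \<Sum>j\<in>B. \<integral>x. f i j x \<partial>M)"
proof -
  have "(\<integral>x. (\<Sum>i\<in>A. \<Sum>j\<in>B. f i j x) \<partial>M) = (\<Sum>i\<in>A. \<integral>x. (\<Sum>j\<in>B. f i j x) \<partial>M)"
    by (intro Bochner_Integration.integral_sum Bochner_Integration.integrable_sum assms)
  also have "\<dots> = (\<Sum>i\<in>A. \<Sum>j\<in>B. \<integral>x. f i j x \<partial>M)"
    by (intro sum.cong refl Bochner_Integration.integral_sum assms)
  finally show ?thesis .
qed

text \<open>Two linear relations link the spread \<open>?D\<close> to the diagonal second moment
  \<open>?P\<close>: constancy of the trace gives \<open>?D = 2 n ?P - 2 ?t\<close>, and the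
  previous identity with constancy of the Frobenius norm gives \<open>?D = 4 ?q - 4 ?P\<close>.
  Eliminating \<open>?P\<close> leaves a multiple of the spread of \<open>x\<close>.\<close>

lemma integral_diagonal_spread:
  assumes "haar_orthogonal n \<mu>"
  shows "(\<integral>U. (\<Sum>i<n. \<Sum>j<n. (conj_diag n x U i i - conj_diag n x U j j)\<^sup>2) \<partial>\<mu>)
    = 2 / (real n + 2) * (\<Sum>k<n. \<Sum>l<n. (x k - x l)\<^sup>2)"
proof (cases "n = 0")
  case False
  interpret prob_space \<mu> by (rule haar_orthogonalD(1)[OF assms])
  let ?S = "conj_diag n x"
  let ?D = "\<integral>U. (\<Sum>i<n. \<Sum>j<n. (?S U i i - ?S U j j)\<^sup>2) \<partial>\<mu>"
  let ?P = "\<integral>U. (\<Sum>i<n. (?S U i i)\<^sup>2) \<partial>\<mu>"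
  let ?q = "\<Sum>k<n. (x k)\<^sup>2" and ?t = "(\<Sum>k<n. x k)\<^sup>2"
  note int = integrable_conj_diag_square[OF assms] integrable_conj_diag_square(1)[OF assms]
  note in_O = haar_orthogonalD(2)[OF assms]
  have iP: "integrable \<mu> (\<lambda>U. \<Sum>i<n. (?S U i i)\<^sup>2)"
    by (intro Bochner_Integration.integrable_sum int) auto
  have "?D = (\<integral>U. 2 * real n * (\<Sum>i<n. (?S U i i)\<^sup>2) - 2 * ?t \<partial>\<mu>)"
    by (intro Bochner_Integration.integral_cong refl)
      (simp add: in_O sum_square_differences trace_conj_diag)
  also have "\<dots> = 2 * real n * ?P - 2 * ?t"
    using iP by (simp add: prob_space)
  finally have DP: "?D = 2 * real n * ?P - 2 * ?t" .
  have "?D = (\<Sum>i<n. \<Sum>j<n. \<integral>U. (?S U i i - ?S U j j)\<^sup>2 \<partial>\<mu>)"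
    by (intro integral_double_sum int) auto
  \<comment> \<open>For i = j the left integral vanishes while the term with factor 4 does not; the
    subtraction lets the sum run over all pairs.\<close>
  also have "\<dots> = (\<Sum>i<n. \<Sum>j<n. 4 * (\<integral>U. (?S U i j)\<^sup>2 \<partial>\<mu>) - (if i = j then 4 * (\<integral>U. (?S U i i)\<^sup>2 \<partial>\<mu>) else 0))"
    by (intro sum.cong refl) (auto simp: integral_diagonal_difference[OF assms])
  also have "\<dots> = 4 * (\<Sum>i<n. \<Sum>j<n. \<integral>U. (?S U i j)\<^sup>2 \<partial>\<mu>) - 4 * (\<Sum>i<n. \<integral>U. (?S U i i)\<^sup>2 \<partial>\<mu>)"
    by (simp add: sum_subtractf sum_distrib_left)
  also have "(\<Sum>i<n. \<integral>U. (?S U i i)\<^sup>2 \<partial>\<mu>) = ?P"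
    by (simp add: Bochner_Integration.integral_sum int)
  also have "(\<Sum>i<n. \<Sum>j<n. \<integral>U. (?S U i j)\<^sup>2 \<partial>\<mu>) = (\<integral>U. (\<Sum>i<n. \<Sum>j<n. (?S U i j)\<^sup>2) \<partial>\<mu>)"
    by (intro integral_double_sum[symmetric] int) auto
  also have "\<dots> = (\<integral>U. ?q \<partial>\<mu>)"
    by (intro Bochner_Integration.integral_cong refl) (simp add: in_O sum_squares_conj_diag)
  also have "\<dots> = ?q"
    by (simp add: prob_space)
  finally have DQ: "?D = 4 * ?q - 4 * ?P" .
  have "(real n + 2) * ?D = 2 * (2 * real n * ?q - 2 * ?t)"
  proof -
    \<comment> \<open>The elimination of \<open>P\<close> is done over real variables, away from the
      integrals.\<close>
    have "(m + 2) * D = 2 * (2 * m * q - 2 * t)"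
      if "D = 2 * m * P - 2 * t" "D = 4 * q - 4 * P" for D m P q t :: real
    proof -
      have "(m + 2) * D = m * (4 * q - 4 * P) + 2 * (2 * m * P - 2 * t)"
        by (simp only: that(1)[symmetric] that(2)[symmetric] distrib_right)
      then show ?thesis
        by (simp add: algebra_simps)
    qed
    then show ?thesis
      using DP DQ .
  qed
  then show ?thesis
    unfolding sum_square_differences[of x n] by (simp add: field_simps)
qed simp

section \<open>Row norms and their expected variance for a given decomposition\<close>

lemma svd_mat_entry:
  assumes "U \<in> carrier_mat n n" "V \<in> carrier_mat n n" "i < n" "j < n"
  shows "svd_mat n \<tau> V U $$ (i, j) = (\<Sum>k<n. U $$ (i, k) * \<tau> k * V $$ (j, k))"
proof -
  have "U * mat_diag n \<tau> \<in> carrier_mat n n"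
    using assms by auto
  then show ?thesis
    using assms unfolding svd_mat_def
    by (subst mult_mat_entry[where m = n and p = n and q = n])
      (auto simp: mat_diag_mult_right intro!: sum.cong)
qed

lemma svd_mat_carrier:
  assumes "U \<in> carrier_mat n n" "V \<in> carrier_mat n n"
  shows "svd_mat n \<tau> V U \<in> carrier_mat n n"
  unfolding svd_mat_def using assms by (intro mult_carrier_mat[of _ n n]) auto

text \<open>Orthonormality of the columns of \<open>V\<close> makes \<open>V\<close> disappear. The
  diagonal \<open>\<tau>\<close> may have any sign, as \<open>ns_poly a b c (\<sigma> k)\<close> can
  be negative.\<close>

lemma svd_mat_row_square:
  assumes "U \<in> carrier_mat n n" "V \<in> orthogonal_group n" "i < n"
  shows "(\<Sum>j<n. (svd_mat n \<tau> V U $$ (i, j))\<^sup>2) = conj_diag n (\<lambda>k. (\<tau> k)\<^sup>2) U i i"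
proof -
  let ?w = "\<lambda>k. U $$ (i, k) * \<tau> k"
  have "(\<Sum>j<n. (svd_mat n \<tau> V U $$ (i, j))\<^sup>2) =
      (\<Sum>j<n. \<Sum>k<n. \<Sum>l<n. (?w k * V $$ (j, k)) * (?w l * V $$ (j, l)))"
    using assms by (simp add: svd_mat_entry[OF _ orthogonal_groupD(1)] power2_eq_square sum_product)
  also have "\<dots> = (\<Sum>k<n. \<Sum>l<n. \<Sum>j<n. (?w k * V $$ (j, k)) * (?w l * V $$ (j, l)))"
    by (rule sum_rotate_three)
  also have "\<dots> = (\<Sum>k<n. \<Sum>l<n. ?w k * ?w l * (\<Sum>j<n. V $$ (j, k) * V $$ (j, l)))"
    by (simp add: sum_distrib_left mult_ac)
  also have "\<dots> = (\<Sum>k<n. \<Sum>l<n. if k = l then ?w k * ?w l else 0)"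
    by (intro sum.cong refl) (use assms in \<open>auto simp: orthogonal_group_iff\<close>)
  finally show ?thesis
    by (simp add: conj_diag_def power2_eq_square mult_ac)
qed

text \<open>Summing the row norms gives a trace, which does not depend on \<open>U\<close>. The norm
  condition in \<open>admissible\<close> thus becomes a condition on \<open>\<sigma>\<close>
  alone.\<close>

lemma svd_mat_frobenius:
  assumes "U \<in> orthogonal_group n" "V \<in> orthogonal_group n"
  shows "(frobenius_norm (svd_mat n \<tau> V U))\<^sup>2 = (\<Sum>k<n. (\<tau> k)\<^sup>2)"
proof -
  have "svd_mat n \<tau> V U \<in> carrier_mat n n"
    using assms by (intro svd_mat_carrier orthogonal_groupD)
  then have "(frobenius_norm (svd_mat n \<tau> V U))\<^sup>2 = (\<Sum>i<n. \<Sum>j<n. (svd_mat n \<tau> V U $$ (i, j))\<^sup>2)"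
    by (simp add: frobenius_norm_def sum_nonneg)
  also have "\<dots> = (\<Sum>i<n. conj_diag n (\<lambda>k. (\<tau> k)\<^sup>2) U i i)"
    using assms by (simp add: svd_mat_row_square orthogonal_groupD(1))
  finally show ?thesis
    using assms by (simp add: trace_conj_diag)
qed

text \<open>The mean of the row norms is the trace divided by n, so this is the usual expression of
  a variance through pairwise differences, the form whose integral is known.\<close>

lemma row_norm_variance_svd:
  assumes "U \<in> orthogonal_group n" "V \<in> orthogonal_group n" "0 < n"
  shows "row_norm_variance (svd_mat n \<tau> V U) = 1 / (2 * (real n)\<^sup>2) *
    (\<Sum>i<n. \<Sum>j<n. (conj_diag n (\<lambda>k. (\<tau> k)\<^sup>2) U i i - conj_diag n (\<lambda>k. (\<tau> k)\<^sup>2) U j j)\<^sup>2)"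
proof -
  let ?y = "\<lambda>i. conj_diag n (\<lambda>k. (\<tau> k)\<^sup>2) U i i"
  let ?m = "1 / real n * (\<Sum>i<n. ?y i)"
  have c: "svd_mat n \<tau> V U \<in> carrier_mat n n"
    using assms by (intro svd_mat_carrier orthogonal_groupD)
  have "row_norm_variance (svd_mat n \<tau> V U) = 1 / real n * (\<Sum>i<n. (?y i - ?m)\<^sup>2)"
    using c assms unfolding row_norm_variance_def sq_row_norms_def svd_mat_frobenius[OF assms(1,2)]
    by (simp add: svd_mat_row_square orthogonal_groupD(1) trace_conj_diag)
  also have "(\<Sum>i<n. (?y i - ?m)\<^sup>2) = (\<Sum>i<n. (?y i)\<^sup>2 + ?m\<^sup>2 - 2 * ?m * ?y i)"
    by (simp add: power2_diff algebra_simps)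
  also have "\<dots> = (\<Sum>i<n. (?y i)\<^sup>2) + real n * ?m\<^sup>2 - 2 * ?m * (\<Sum>i<n. ?y i)"
    by (simp only: sum.distrib sum_subtractf sum_distrib_left[symmetric] sum_constant card_lessThan)
  also have "1 / real n * \<dots> =
      1 / (2 * (real n)\<^sup>2) * (2 * real n * (\<Sum>i<n. (?y i)\<^sup>2) - 2 * (\<Sum>i<n. ?y i)\<^sup>2)"
    using assms(3) by (simp add: field_simps power2_eq_square)
  finally show ?thesis
    unfolding sum_square_differences .
qed

lemma expected_row_norm_variance_svd:
  assumes "haar_orthogonal n \<mu>" "V \<in> orthogonal_group n" "0 < n"
  shows "integrable \<mu> (\<lambda>U. row_norm_variance (svd_mat n \<tau> V U))"
    and "(\<integral>U. row_norm_variance (svd_mat n \<tau> V U) \<partial>\<mu>) =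
      (\<Sum>k<n. \<Sum>l<n. ((\<tau> k)\<^sup>2 - (\<tau> l)\<^sup>2)\<^sup>2) / ((real n)\<^sup>2 * (real n + 2))"
proof -
  let ?S = "conj_diag n (\<lambda>k. (\<tau> k)\<^sup>2)"
  let ?h = "\<lambda>U. 1 / (2 * (real n)\<^sup>2) * (\<Sum>i<n. \<Sum>j<n. (?S U i i - ?S U j j)\<^sup>2)"
  \<comment> \<open>The pairwise formula holds for orthogonal \<open>U\<close>, hence on the space
    of \<open>\<mu>\<close>.\<close>
  have eq: "row_norm_variance (svd_mat n \<tau> V U) = ?h U" if "U \<in> space \<mu>" for U
    using that assms haar_orthogonalD(2)[OF assms(1)] by (intro row_norm_variance_svd) auto
  have "integrable \<mu> ?h"
    by (intro integrable_mult_right Bochner_Integration.integrable_sum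
        integrable_conj_diag_square(2)[OF assms(1)]) auto
  then show "integrable \<mu> (\<lambda>U. row_norm_variance (svd_mat n \<tau> V U))"
    using Bochner_Integration.integrable_cong[of \<mu> \<mu> "\<lambda>U. row_norm_variance (svd_mat n \<tau> V U)" ?h] eq
    by blast
  have "(\<integral>U. row_norm_variance (svd_mat n \<tau> V U) \<partial>\<mu>) = (\<integral>U. ?h U \<partial>\<mu>)"
    by (intro Bochner_Integration.integral_cong refl eq)
  also have "\<dots> = 1 / (2 * (real n)\<^sup>2) * (2 / (real n + 2) * (\<Sum>k<n. \<Sum>l<n. ((\<tau> k)\<^sup>2 - (\<tau> l)\<^sup>2)\<^sup>2))"
    by (simp only: integral_mult_right_zero integral_diagonal_spread[OF assms(1)])
  finally show "(\<integral>U. row_norm_variance (svd_mat n \<tau> V U) \<partial>\<mu>) =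
      (\<Sum>k<n. \<Sum>l<n. ((\<tau> k)\<^sup>2 - (\<tau> l)\<^sup>2)\<^sup>2) / ((real n)\<^sup>2 * (real n + 2))"
    by simp
qed

section \<open>The polar step on singular values and the expected shift\<close>

lemma transpose_mat_diag: "transpose_mat (mat_diag n f) = mat_diag n f"
  by (auto simp: mat_diag_def)

lemma newton_schulz_svd:
  assumes "U \<in> orthogonal_group n" "V \<in> orthogonal_group n"
  shows "newton_schulz a b c (svd_mat n \<sigma> V U) = svd_mat n (\<lambda>k. ns_poly a b c (\<sigma> k)) V U"
proof -
  note cU = orthogonal_groupD(1)[OF assms(1)] and cV = orthogonal_groupD(1)[OF assms(2)]
  note as = assoc_mult_mat[of _ n n _ n _ n] mult_carrier_mat[of _ n n _ n] left_mult_one_mat[of _ n n]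
  \<comment> \<open>Cancelling \<open>U^T U\<close> turns multiplication by
    \<open>U diag(f) U^T\<close> into scaling of the diagonal. With
    \<open>M M^T = U diag(\<sigma>^2) U^T\<close>, one application yields the cubes and a second one
    the fifth powers.\<close>
  have svd_mult: "U * mat_diag n f * transpose_mat U * svd_mat n g V U = svd_mat n (\<lambda>k. f k * g k) V U"
    for f g
  proof -
    have "U * mat_diag n f * transpose_mat U * svd_mat n g V U =
        U * (mat_diag n f * ((transpose_mat U * U) * (mat_diag n g * transpose_mat V)))"
      using cU cV unfolding svd_mat_def by (simp add: as)
    also have "\<dots> = U * ((mat_diag n f * mat_diag n g) * transpose_mat V)"
      using cU cV unfolding orthogonal_groupD(4)[OF assms(1)] by (simp add: as del: mat_diag_diag)
    finally show ?thesis
      using cU cV by (simp add: svd_mat_def as)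
  qed
  let ?M = "svd_mat n \<sigma> V U"
  have cM: "svd_mat n f V U \<in> carrier_mat n n" for f
    using cU cV by (rule svd_mat_carrier)
  have tM: "transpose_mat ?M = V * (mat_diag n \<sigma> * transpose_mat U)"
    using cU cV by (simp add: svd_mat_def transpose_mult[of _ n n _ n] transpose_mat_diag)
  have "?M * transpose_mat ?M =
      U * (mat_diag n \<sigma> * ((transpose_mat V * V) * (mat_diag n \<sigma> * transpose_mat U)))"
    using cU cV unfolding tM unfolding svd_mat_def by (simp add: as)
  also have "\<dots> = U * ((mat_diag n \<sigma> * mat_diag n \<sigma>) * transpose_mat U)"
    using cU cV unfolding orthogonal_groupD(4)[OF assms(2)] by (simp add: as del: mat_diag_diag)
  finally have G: "?M * transpose_mat ?M = U * mat_diag n (\<lambda>k. \<sigma> k * \<sigma> k) * transpose_mat U"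
    using cU by (simp add: as)
  have cG: "?M * transpose_mat ?M \<in> carrier_mat n n"
    using cM by (intro mult_carrier_mat[of _ n n]) auto
  have M3: "?M * transpose_mat ?M * ?M = svd_mat n (\<lambda>k. \<sigma> k ^ 3) V U"
    unfolding G svd_mult by (simp add: power3_eq_cube)
  have "(?M * transpose_mat ?M) ^\<^sub>m 2 * ?M = (?M * transpose_mat ?M) * (?M * transpose_mat ?M * ?M)"
    using cG cM by (simp add: numeral_2_eq_2 as)
  also have "\<dots> = svd_mat n (\<lambda>k. \<sigma> k ^ 5) V U"
    unfolding M3 unfolding G svd_mult
    by (simp add: power2_eq_square[symmetric] power_add[symmetric])
  finally have M5: "(?M * transpose_mat ?M) ^\<^sub>m 2 * ?M = svd_mat n (\<lambda>k. \<sigma> k ^ 5) V U" .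
  show ?thesis
    unfolding newton_schulz_def M3 M5
  proof (rule eq_matI)
    fix i j
    assume "i < dim_row (svd_mat n (\<lambda>k. ns_poly a b c (\<sigma> k)) V U)"
      and "j < dim_col (svd_mat n (\<lambda>k. ns_poly a b c (\<sigma> k)) V U)"
    then have "i < n" "j < n"
      using carrier_matD[OF cM] by simp_all
    then show "(a \<cdot>\<^sub>m ?M + b \<cdot>\<^sub>m svd_mat n (\<lambda>k. \<sigma> k ^ 3) V U + c \<cdot>\<^sub>m svd_mat n (\<lambda>k. \<sigma> k ^ 5) V U) $$ (i, j)
        = svd_mat n (\<lambda>k. ns_poly a b c (\<sigma> k)) V U $$ (i, j)"
      using carrier_matD[OF cM] cU cV
      by (simp add: svd_mat_entry ns_poly_def sum_distrib_left sum.distrib[symmetric] algebra_simps)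
  qed (simp_all add: carrier_matD[OF cM])
qed

lemma expected_variance_shift_eq:
  assumes "haar_orthogonal n \<mu>" "V \<in> orthogonal_group n" "0 < n"
  shows "expected_variance_shift a b c n \<sigma> V \<mu> =
    (\<Sum>k<n. \<Sum>l<n. ((ns_poly a b c (\<sigma> k))\<^sup>2 - (ns_poly a b c (\<sigma> l))\<^sup>2)\<^sup>2 - ((\<sigma> k)\<^sup>2 - (\<sigma> l)\<^sup>2)\<^sup>2)
      / ((real n)\<^sup>2 * (real n + 2))"
proof -
  note E = expected_row_norm_variance_svd[OF assms]
  have "expected_variance_shift a b c n \<sigma> V \<mu> =
      (\<integral>U. row_norm_variance (svd_mat n (\<lambda>k. ns_poly a b c (\<sigma> k)) V U)
        - row_norm_variance (svd_mat n \<sigma> V U) \<partial>\<mu>)"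
    unfolding expected_variance_shift_def
    using assms(2) haar_orthogonalD(2)[OF assms(1)]
    by (intro Bochner_Integration.integral_cong refl) (simp add: newton_schulz_svd)
  also have "\<dots> = (\<integral>U. row_norm_variance (svd_mat n (\<lambda>k. ns_poly a b c (\<sigma> k)) V U) \<partial>\<mu>)
      - (\<integral>U. row_norm_variance (svd_mat n \<sigma> V U) \<partial>\<mu>)"
    by (intro Bochner_Integration.integral_diff E)
  finally show ?thesis
    unfolding E(2) by (simp add: sum_subtractf diff_divide_distrib)
qed

text \<open>
  In the variable \<open>\<lambda> = \<sigma>\<^sup>2\<close> the squared singular values transform by
  \<open>\<lambda> (a + b \<lambda> + c \<lambda>\<^sup>2)\<^sup>2\<close>, whose derivative at 0 is \<open>a\<^sup>2 > 1\<close>.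
\<close>

lemma ns_poly_square_expands:
  assumes "a > 1"
  obtains \<delta> where "\<delta> > 0"
    "\<And>s t. s\<^sup>2 \<le> \<delta> \<Longrightarrow> t\<^sup>2 \<le> \<delta> \<Longrightarrow> s\<^sup>2 \<noteq> t\<^sup>2 \<Longrightarrow>
      (s\<^sup>2 - t\<^sup>2)\<^sup>2 < ((ns_poly a b c s)\<^sup>2 - (ns_poly a b c t)\<^sup>2)\<^sup>2"
proof -
  \<comment> \<open>\<open>g\<close> satisfies \<open>g (r^2) = (ns_poly a b c r)^2\<close>. As a
    polynomial on the whole line it has a two-sided derivative at 0.\<close>
  define g where "g = (\<lambda>x::real. x * (a + b * x + c * x\<^sup>2)\<^sup>2)"
  define g' where "g' = (\<lambda>x::real. (a + b * x + c * x\<^sup>2)\<^sup>2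
    + x * (2 * (a + b * x + c * x\<^sup>2) * (b + 2 * c * x)))"
  have deriv: "(g has_real_derivative g' x) (at x)" for x
    unfolding g_def g'_def by (auto intro!: derivative_eq_intros simp: algebra_simps)
  have "isCont g' 0"
    unfolding g'_def by (intro continuous_intros)
  moreover have "g' 0 > 1"
    using assms by (simp add: g'_def)
  ultimately have "eventually (\<lambda>x. g' x > 1) (at 0)"
    unfolding isCont_def by (rule order_tendstoD)
  \<comment> \<open>The neighbourhood is punctured; this is enough, since the intermediate point of
    the mean value theorem below is strictly positive. Halving \<open>d\<close> keeps the closed
    interval inside the open one.\<close>
  then obtain d where d: "d > 0" "\<And>x. x \<noteq> 0 \<Longrightarrow> \<bar>x\<bar> < d \<Longrightarrow> g' x > 1"
    unfolding eventually_at by (auto simp: dist_real_def)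
  have mono: "(x - y)\<^sup>2 < (g x - g y)\<^sup>2" if xy: "0 \<le> y" "y < x" "x \<le> d / 2" for x y
  proof -
    obtain z where z: "y < z" "z < x" "g x - g y = (x - y) * g' z"
      using MVT2[OF xy(2), of g g'] deriv by blast
    then have "g' z > 1"
      using xy d by (intro d) auto
    then have "x - y < g x - g y"
      using z xy by simp
    then show ?thesis
      using xy by (intro power_strict_mono) auto
  qed
  show thesis
  proof (rule that[of "d / 2"])
    fix s t :: real
    assume *: "s\<^sup>2 \<le> d / 2" "t\<^sup>2 \<le> d / 2" "s\<^sup>2 \<noteq> t\<^sup>2"
    have "ns_poly a b c r = r * (a + b * r\<^sup>2 + c * (r\<^sup>2)\<^sup>2)" for r
      by (simp add: ns_poly_def algebra_simps eval_nat_numeral)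
    then have eq: "(ns_poly a b c r)\<^sup>2 = g (r\<^sup>2)" for r
      by (simp add: g_def power_mult_distrib)
    show "(s\<^sup>2 - t\<^sup>2)\<^sup>2 < ((ns_poly a b c s)\<^sup>2 - (ns_poly a b c t)\<^sup>2)\<^sup>2"
      using mono[of "s\<^sup>2" "t\<^sup>2"] mono[of "t\<^sup>2" "s\<^sup>2"] *
      unfolding eq by (cases "s\<^sup>2 < t\<^sup>2") (auto simp: power2_commute)
  qed (use d in simp)
qed

theorem corollary2p2:
  fixes a b c :: real
  assumes "deriv (ns_poly a b c) 0 > 1"
  shows "(\<exists>\<delta>>0. \<forall>n \<sigma> V \<mu>.
            admissible n \<sigma> V \<longrightarrow> haar_orthogonal n \<mu> \<longrightarrow>
            (\<forall>k<n. (\<sigma> k)\<^sup>2 \<in> {0..\<delta>}) \<longrightarrow>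
            (\<exists>k<n. \<exists>l<n. (\<sigma> k)\<^sup>2 \<noteq> (\<sigma> l)\<^sup>2) \<longrightarrow>
            expected_variance_shift a b c n \<sigma> V \<mu> > 0)
       \<and> (\<exists>n \<sigma> V. admissible n \<sigma> V \<and>
            (\<forall>\<mu>. haar_orthogonal n \<mu> \<longrightarrow> expected_variance_shift a b c n \<sigma> V \<mu> > 0))"
proof -
  have "a > 1"
    using assms by (simp add: deriv_ns_poly_0)
  \<comment> \<open>This \<open>\<delta>\<close> comes from a scalar inequality in \<open>a\<close>,
    \<open>b\<close>, \<open>c\<close> only, hence is uniform in the dimension.\<close>
  then obtain \<delta> where \<delta>: "\<delta> > 0"
    "\<And>s t. s\<^sup>2 \<le> \<delta> \<Longrightarrow> t\<^sup>2 \<le> \<delta> \<Longrightarrow> s\<^sup>2 \<noteq> t\<^sup>2 \<Longrightarrow>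
      (s\<^sup>2 - t\<^sup>2)\<^sup>2 < ((ns_poly a b c s)\<^sup>2 - (ns_poly a b c t)\<^sup>2)\<^sup>2"
    using ns_poly_square_expands[of a b c] by blast
  have pos: "expected_variance_shift a b c n \<sigma> V \<mu> > 0"
    if adm: "admissible n \<sigma> V" and haar: "haar_orthogonal n \<mu>"
      and small: "\<forall>k<n. (\<sigma> k)\<^sup>2 \<in> {0..\<delta>}"
      and unequal: "\<exists>k<n. \<exists>l<n. (\<sigma> k)\<^sup>2 \<noteq> (\<sigma> l)\<^sup>2" for n \<sigma> V \<mu>
  proof -
    obtain k l where kl: "k < n" "l < n" "(\<sigma> k)\<^sup>2 \<noteq> (\<sigma> l)\<^sup>2"
      using unequal by blast
    let ?t = "\<lambda>k l. ((ns_poly a b c (\<sigma> k))\<^sup>2 - (ns_poly a b c (\<sigma> l))\<^sup>2)\<^sup>2 - ((\<sigma> k)\<^sup>2 - (\<sigma> l)\<^sup>2)\<^sup>2"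
    \<comment> \<open>For equal squares the subtracted term is 0 and a square remains; otherwise the
      strict expansion applies.\<close>
    have nonneg: "0 \<le> ?t i j" if "i < n" "j < n" for i j
      using \<delta>(2)[of "\<sigma> i" "\<sigma> j"] small that by (cases "(\<sigma> i)\<^sup>2 = (\<sigma> j)\<^sup>2") auto
    have "0 < ?t k l"
      using \<delta>(2)[of "\<sigma> k" "\<sigma> l"] small kl by auto
    then have "0 < (\<Sum>j<n. ?t k j)"
      using kl nonneg by (intro sum_pos2[of _ l]) auto
    moreover have "0 \<le> (\<Sum>j<n. ?t i j)" if "i < n" for i
      using nonneg that by (intro sum_nonneg) auto
    ultimately have "0 < (\<Sum>i<n. \<Sum>j<n. ?t i j)"
      by (rule sum_pos2[where i = k, rotated 2]) (use kl in auto)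
    moreover have "expected_variance_shift a b c n \<sigma> V \<mu> = (\<Sum>i<n. \<Sum>j<n. ?t i j) / ((real n)\<^sup>2 * (real n + 2))"
      using adm haar kl by (intro expected_variance_shift_eq) (auto simp: admissible_def)
    ultimately show ?thesis
      using kl by simp
  qed
  \<comment> \<open>An admissible example: one singular value 0 and N equal to
    \<open>1 / sqrt N\<close>, in dimension N + 1. The squares sum to 1, so making them all small
    forces a large dimension; the zero makes them unequal.\<close>
  obtain N :: nat where N: "0 < N" "1 / real N < \<delta>"
    using \<delta>(1) by (metis nat_approx_posE zero_less_Suc)
  define \<sigma> where "\<sigma> = (\<lambda>k::nat. if k = 0 then 0 else 1 / sqrt (real N))"
  have "(\<Sum>k<Suc N. (\<sigma> k)\<^sup>2) = 1"
    using N by (simp add: sum.lessThan_Suc_shift \<sigma>_def power_divide del: sum.lessThan_Suc)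
  then have "admissible (Suc N) \<sigma> (1\<^sub>m (Suc N))"
    using N by (auto simp: admissible_def one_mat_orthogonal svd_mat_frobenius \<sigma>_def real_le_rsqrt)
  moreover have "\<forall>k<Suc N. (\<sigma> k)\<^sup>2 \<in> {0..\<delta>}"
    using N \<delta>(1) by (auto simp: \<sigma>_def power_divide)
  moreover have "\<exists>k<Suc N. \<exists>l<Suc N. (\<sigma> k)\<^sup>2 \<noteq> (\<sigma> l)\<^sup>2"
    using N by (intro exI[of _ 0] exI[of _ 1] conjI) (auto simp: \<sigma>_def)
  ultimately show ?thesis
    using pos \<delta>(1) by blast
qed

end
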